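(* Let $p:[a,b]\to\mathbb{R}$ ($a<b$) be an increasing polynomial of degree $m\ge 1$, and let $s-1\ge 0$ be the largest order of the zeros that $p'$ may have in $[a,b]$ (with $s-1=0$ if $p'$ has no zeros in $[a,b]$). Then there exist $\delta>0$ and $K>0$ such that for all $u,v\in[p(a),p(b)]$ with $|u-v|\le\delta$, $$\left|p^{-1}(u)-p^{-1}(v)\right|\le K|u-v|^{1/s}.$$ Hence, for some $K'>0$, one has $\left|p^{-1}(u)-p^{-1}(v)\right|\le K'|u-v|^{1/m}$ for all such $u,v$.
   Context: $p^{-1}:[p(a),p(b)]\to[a,b]$ is the inverse of $p$ on $[a,b]$ (a non-constant increasing polynomial is strictly increasing). *)

theory Defs
  imports Complex_Main "HOL-Computational_Algebra.Polynomial"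
begin

text \<open>
  The maximum below is over a finite set whenever \<open>q \<noteq> 0\<close>; it is meaningless for \<open>q = 0\<close>,
  where \<^const>\<open>order\<close> is unspecified.
\<close>

definition max_zero_order :: "real poly \<Rightarrow> real set \<Rightarrow> nat" where
  "max_zero_order q S =
     (if \<exists>x\<in>S. poly q x = 0 then Max {order x q | x. x \<in> S \<and> poly q x = 0} else 0)"

end

theory Submission
  imports Defs
begin

text \<open>
  The point is the lower bound \<open>p y - p x \<ge> c * (y - x) ^ s\<close> for \<open>a \<le> x \<le> y \<le> b\<close>; the estimate on
  the inverse follows by taking \<open>s\<close>-th roots.

  Near a point \<open>z\<close> of \<open>[a, b]\<close> one can write \<open>p' t = (t - z) ^ k * r t\<close> with \<open>r z \<noteq> 0\<close> and
  \<open>k \<le> s - 1\<close>, so \<open>\<bar>p' t\<bar> \<ge> c * \<bar>t - z\<bar> ^ k\<close>. The first or the last quarter of \<open>[x, y]\<close> stays at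
  distance at least \<open>(y - x) / 4\<close> from \<open>z\<close>, and the mean value theorem on that quarter, together with
  monotonicity on the rest, gives the lower bound near \<open>z\<close>
  (\<open>poly_increment_ge_power_local\<close>). The bound is inherited, with a smaller constant, by the union of
  two adjacent intervals (\<open>increment_ge_power_join\<close>), because a subinterval of the union has at
  least half of its length in one of the two. Bolzano's bisection principle therefore spreads it to
  all of \<open>[a, b]\<close> (\<open>poly_increment_ge_power\<close>).

  The second estimate follows from the first because \<open>s \<le> m\<close> and, for \<open>\<bar>u - v\<bar> \<le> 1\<close>, decreasing the
  exponent can only increase the power. So \<open>\<delta> = 1\<close> serves both parts.
\<close>

lemma finite_zero_orders:
  fixes q :: "real poly"
  assumes "q \<noteq> 0"
  shows "finite {order x q | x. x \<in> S \<and> poly q x = 0}"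
proof -
  have "{order x q | x. x \<in> S \<and> poly q x = 0} \<subseteq> (\<lambda>x. order x q) ` {x. poly q x = 0}"
    by auto
  then show ?thesis
    using poly_roots_finite[OF assms] finite_surj by blast
qed

lemma order_le_max_zero_order:
  assumes "q \<noteq> 0" "x \<in> S"
  shows "order x q \<le> max_zero_order q S"
proof (cases "poly q x = 0")
  case True
  then show ?thesis
    using assms Max_ge[OF finite_zero_orders[OF assms(1), of S], of "order x q"]
    by (auto simp: max_zero_order_def)
next
  case False
  then show ?thesis by (simp add: order_0I)
qed

lemma max_zero_order_le_degree:
  assumes "q \<noteq> 0"
  shows "max_zero_order q S \<le> degree q"
proof (cases "\<exists>x\<in>S. poly q x = 0")
  case True
  let ?A = "{order x q | x. x \<in> S \<and> poly q x = 0}"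
  have "Max ?A \<in> ?A"
    using True by (intro Max_in finite_zero_orders assms) auto
  then show ?thesis
    using True order_degree[OF assms] by (auto simp: max_zero_order_def)
next
  case False
  then show ?thesis by (auto simp: max_zero_order_def)
qed

lemma poly_ge_power_order_local:
  fixes q :: "real poly"
  assumes "q \<noteq> 0"
  shows "\<exists>c>0. \<exists>d>0. \<forall>t. \<bar>t - z\<bar> < d \<longrightarrow> c * \<bar>t - z\<bar> ^ order z q \<le> \<bar>poly q t\<bar>"
proof -
  obtain r where r: "q = [:- z, 1:] ^ order z q * r" "\<not> [:- z, 1:] dvd r"
    using order_decomp[OF assms] by blast
  have rz: "poly r z \<noteq> 0"
    using r(2) by (simp add: poly_eq_0_iff_dvd)
  define c where "c = \<bar>poly r z\<bar> / 2"
  have c: "c > 0" using rz by (simp add: c_def)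
  have "isCont (poly r) z" by simp
  then obtain d where d: "d > 0" "\<And>t. t \<noteq> z \<Longrightarrow> \<bar>t - z\<bar> < d \<Longrightarrow> \<bar>poly r t - poly r z\<bar> < c"
    using c unfolding isCont_def LIM_eq real_norm_def by blast
  have "c * \<bar>t - z\<bar> ^ order z q \<le> \<bar>poly q t\<bar>" if "\<bar>t - z\<bar> < d" for t
  proof -
    have "\<bar>poly r t - poly r z\<bar> < c"
      using d(2)[of t] that c by (cases "t = z") auto
    then have "c \<le> \<bar>poly r t\<bar>"
      unfolding c_def by linarith
    then have "c * \<bar>t - z\<bar> ^ order z q \<le> \<bar>poly r t\<bar> * \<bar>t - z\<bar> ^ order z q"
      by (rule mult_right_mono) simp
    also have "\<dots> = \<bar>poly q t\<bar>"
      by (subst r(1)) (simp add: abs_mult power_abs mult.commute)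
    finally show ?thesis .
  qed
  then show ?thesis using c d(1) by blast
qed

lemma poly_increment_ge_power_local:
  fixes p :: "real poly"
  assumes mono: "mono_on {a..b} (poly p)" and nz: "pderiv p \<noteq> 0"
    and ord: "order z (pderiv p) < s"
  shows "\<exists>d>0. \<exists>c>0. \<forall>x y. a \<le> x \<and> x \<le> y \<and> y \<le> b \<and> \<bar>x - z\<bar> < d \<and> \<bar>y - z\<bar> < d
           \<longrightarrow> c * (y - x) ^ s \<le> poly p y - poly p x"
proof -
  let ?k = "order z (pderiv p)"
  obtain c d where c: "c > 0" and d: "d > 0"
    and cd: "\<And>t. \<bar>t - z\<bar> < d \<Longrightarrow> c * \<bar>t - z\<bar> ^ ?k \<le> \<bar>poly (pderiv p) t\<bar>"
    using poly_ge_power_order_local[OF nz, of z] by blast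
  \<comment> \<open>The radius is at most 1 so that \<open>y - x < 2\<close>: then \<open>h = (y - x) / 4 \<le> 1\<close>, and the exponent
    \<open>k + 1\<close> may be raised to \<open>s\<close>.\<close>
  have "c / 4 ^ s * (y - x) ^ s \<le> poly p y - poly p x"
    if xy: "a \<le> x" "x \<le> y" "y \<le> b" "\<bar>x - z\<bar> < min d 1" "\<bar>y - z\<bar> < min d 1" for x y
  proof (cases "x = y")
    case True
    then show ?thesis using ord by (simp add: power_0_left)
  next
    case False
    define h where "h = (y - x) / 4"
    have h: "0 < h" "h \<le> 1"
      using xy False by (auto simp: h_def)
    \<comment> \<open>\<open>[l, l + h]\<close> is the last or the first quarter of \<open>[x, y]\<close>, on the side of the midpoint
      away from \<open>z\<close>.\<close>
    define l where "l = (if z \<le> (x + y) / 2 then y - h else x)"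
    have l: "x \<le> l" "l + h \<le> y" "\<And>t. l < t \<Longrightarrow> t < l + h \<Longrightarrow> h \<le> \<bar>t - z\<bar>"
      using h(1) by (auto simp: l_def h_def field_simps split: if_splits)
    obtain t where t: "l < t" "t < l + h"
      "poly p (l + h) - poly p l = (l + h - l) * poly (pderiv p) t"
      using poly_MVT[of l "l + h" p] h(1) by auto
    have mono': "poly p x \<le> poly p l" "poly p l \<le> poly p (l + h)" "poly p (l + h) \<le> poly p y"
      using l h(1) xy by (auto intro!: mono_onD[OF mono])
    have "c / 4 ^ s * (y - x) ^ s = c * h ^ s"
      by (simp add: h_def power_divide)
    also have "\<dots> \<le> c * h ^ Suc ?k"
      using c h ord by (intro mult_left_mono power_decreasing) auto
    also have "\<dots> \<le> h * (c * \<bar>t - z\<bar> ^ ?k)"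
      using c h l(3)[OF t(1,2)] by (auto intro!: mult_left_mono power_mono)
    also have "\<dots> \<le> h * \<bar>poly (pderiv p) t\<bar>"
    proof (intro mult_left_mono cd)
      show "\<bar>t - z\<bar> < d" using t l xy by auto
    qed (use h in auto)
    also have "\<dots> = \<bar>poly p (l + h) - poly p l\<bar>"
      using t(3) h by (simp add: abs_mult)
    also have "\<dots> \<le> poly p y - poly p x"
      using mono' by simp
    finally show ?thesis .
  qed
  moreover have "min d 1 > 0" "c / 4 ^ s > 0"
    using c d by auto
  ultimately show ?thesis by blast
qed

text \<open>
  \<open>f\<close> increases by at least a fixed positive multiple of the \<open>s\<close>-th power of the distance on \<open>S\<close>.
\<close>

definition increment_ge_power :: "(real \<Rightarrow> real) \<Rightarrow> nat \<Rightarrow> real set \<Rightarrow> bool" where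
  "increment_ge_power f s S \<longleftrightarrow>
     (\<exists>c>0. \<forall>x\<in>S. \<forall>y\<in>S. x \<le> y \<longrightarrow> c * (y - x) ^ s \<le> f y - f x)"

lemma increment_ge_power_join:
  assumes mono: "mono_on {a..c} f"
    and left: "increment_ge_power f s {a..b}" and right: "increment_ge_power f s {b..c}"
  shows "increment_ge_power f s {a..c}"
proof -
  obtain k1 where k1: "k1 > 0" "\<And>x y. a \<le> x \<Longrightarrow> x \<le> y \<Longrightarrow> y \<le> b \<Longrightarrow> k1 * (y - x) ^ s \<le> f y - f x"
    using left by (force simp: increment_ge_power_def)
  obtain k2 where k2: "k2 > 0" "\<And>x y. b \<le> x \<Longrightarrow> x \<le> y \<Longrightarrow> y \<le> c \<Longrightarrow> k2 * (y - x) ^ s \<le> f y - f x"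
    using right by (force simp: increment_ge_power_def)
  define k where "k = min k1 k2"
  have k: "k > 0" "k \<le> k1" "k \<le> k2" using k1 k2 by (auto simp: k_def)
  have "k / 2 ^ s * (y - x) ^ s \<le> f y - f x" if xy: "a \<le> x" "x \<le> y" "y \<le> c" for x y
  proof -
    let ?h = "(y - x) / 2"
    have eq: "k / 2 ^ s * (y - x) ^ s = k * ?h ^ s"
      by (simp add: power_divide)
    show ?thesis
    proof (cases "(x + y) / 2 \<le> b")
      case True
      have "k * ?h ^ s \<le> k1 * ((x + y) / 2 - x) ^ s"
        using k xy by (intro mult_mono power_mono) (auto simp: field_simps)
      also have "\<dots> \<le> f ((x + y) / 2) - f x"
        using xy True by (intro k1(2)) auto
      also have "f ((x + y) / 2) \<le> f y"
        using xy by (intro mono_onD[OF mono]) auto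
      finally show ?thesis using eq by linarith
    next
      case False
      have "k * ?h ^ s \<le> k2 * (y - (x + y) / 2) ^ s"
        using k xy by (intro mult_mono power_mono) (auto simp: field_simps)
      also have "\<dots> \<le> f y - f ((x + y) / 2)"
        using xy False by (intro k2(2)) auto
      also have "\<dots> \<le> f y - f x"
        using xy mono_onD[OF mono, of x "(x + y) / 2"] by auto
      finally show ?thesis using eq by linarith
    qed
  qed
  moreover have "k / 2 ^ s > 0" using k by simp
  ultimately show ?thesis
    unfolding increment_ge_power_def by (intro exI[of _ "k / 2 ^ s"]) auto
qed

lemma poly_increment_ge_power:
  fixes p :: "real poly"
  assumes "a \<le> b" and mono: "mono_on {a..b} (poly p)" and nz: "pderiv p \<noteq> 0"
    and ord: "\<And>z. z \<in> {a..b} \<Longrightarrow> order z (pderiv p) < s"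
  shows "increment_ge_power (poly p) s {a..b}"
proof -
  \<comment> \<open>The bisection principle may ask about intervals that stick out of \<open>[a, b]\<close>.\<close>
  define P where "P = (\<lambda>x y. a \<le> x \<and> y \<le> b \<longrightarrow> increment_ge_power (poly p) s {x..y})"
  have "P a b"
  proof (rule Bolzano[OF \<open>a \<le> b\<close>])
    fix x y z assume "P x y" "P y z" "x \<le> y" "y \<le> z"
    then show "P x z"
      using increment_ge_power_join[of x z "poly p" s y] monotone_on_subset[OF mono, of "{x..z}"]
      by (auto simp: P_def)
  next
    fix z assume "a \<le> z" "z \<le> b"
    then obtain d c where dc: "d > 0" "c > 0"
      "\<And>x y. a \<le> x \<Longrightarrow> x \<le> y \<Longrightarrow> y \<le> b \<Longrightarrow> \<bar>x - z\<bar> < d \<Longrightarrow> \<bar>y - z\<bar> < d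
         \<Longrightarrow> c * (y - x) ^ s \<le> poly p y - poly p x"
      using poly_increment_ge_power_local[OF mono nz ord[of z]] by auto
    have "P x y" if "x \<le> z" "z \<le> y" "y - x < d" for x y
      unfolding P_def increment_ge_power_def
      using that \<open>c > 0\<close> by (intro impI exI[of _ c] conjI ballI dc(3)) auto
    then show "\<exists>d>0. \<forall>x y. x \<le> z \<and> z \<le> y \<and> y - x < d \<longrightarrow> P x y"
      using dc(1) by blast
  qed
  then show ?thesis by (simp add: P_def)
qed

lemma poly_inverse_Holder:
  fixes p :: "real poly"
  assumes "a \<le> b" "s \<ge> 1" and inc: "increment_ge_power (poly p) s {a..b}"
  shows "\<exists>K>0. \<forall>u\<in>{poly p a..poly p b}. \<forall>v\<in>{poly p a..poly p b}.
    \<bar>inv_into {a..b} (poly p) u - inv_into {a..b} (poly p) v\<bar> \<le> K * \<bar>u - v\<bar> powr (1 / real s)"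
proof -
  obtain c where c: "c > 0"
    "\<And>x y. x \<in> {a..b} \<Longrightarrow> y \<in> {a..b} \<Longrightarrow> x \<le> y \<Longrightarrow> c * (y - x) ^ s \<le> poly p y - poly p x"
    using inc unfolding increment_ge_power_def by blast
  define K where "K = (1 / c) powr (1 / real s)"
  have root: "\<bar>x - y\<bar> \<le> K * \<bar>poly p x - poly p y\<bar> powr (1 / real s)"
    if xy: "x \<in> {a..b}" "y \<in> {a..b}" for x y
  proof -
    have "c * \<bar>x - y\<bar> ^ s \<le> \<bar>poly p x - poly p y\<bar>"
      using c(2)[of x y] c(2)[of y x] xy by (cases "x \<le> y") auto
    then have "\<bar>x - y\<bar> ^ s \<le> 1 / c * \<bar>poly p x - poly p y\<bar>"
      using c(1) by (simp add: field_simps)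
    then have "(\<bar>x - y\<bar> ^ s) powr (1 / real s) \<le> (1 / c * \<bar>poly p x - poly p y\<bar>) powr (1 / real s)"
      by (intro powr_mono2) auto
    moreover have "(\<bar>x - y\<bar> ^ s) powr (1 / real s) = \<bar>x - y\<bar>"
    proof (cases "x = y")
      case False
      then show ?thesis
        using \<open>s \<ge> 1\<close> by (simp add: powr_powr flip: powr_realpow)
    qed (use \<open>s \<ge> 1\<close> in \<open>simp add: power_0_left\<close>)
    moreover have "(1 / c * \<bar>poly p x - poly p y\<bar>) powr (1 / real s)
        = K * \<bar>poly p x - poly p y\<bar> powr (1 / real s)"
      using c(1) unfolding K_def by (intro powr_mult)
    ultimately show ?thesis by simp
  qed
  \<comment> \<open>Only \<open>p (p\<^sup>-\<^sup>1 u) = u\<close> and \<open>p\<^sup>-\<^sup>1 u \<in> [a, b]\<close> are needed, and these follow from surjectivity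
    alone.\<close>
  have surj: "u \<in> poly p ` {a..b}" if "u \<in> {poly p a..poly p b}" for u
    using IVT'[of "poly p" a u b] that \<open>a \<le> b\<close> by (force intro: continuous_on_poly continuous_on_id)
  have "\<bar>inv_into {a..b} (poly p) u - inv_into {a..b} (poly p) v\<bar> \<le> K * \<bar>u - v\<bar> powr (1 / real s)"
    if "u \<in> {poly p a..poly p b}" "v \<in> {poly p a..poly p b}" for u v
    using root[OF inv_into_into[OF surj] inv_into_into[OF surj], OF that]
    by (simp add: f_inv_into_f surj that del: atLeastAtMost_iff)
  moreover have "K > 0" using c(1) by (simp add: K_def)
  ultimately show ?thesis by blast
qed

theorem theorem6p7:
  fixes p :: "real poly" and a b :: real and m s :: nat
  assumes "a < b"
    and "degree p = m" and "m \<ge> 1"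
    and "mono_on {a..b} (poly p)"
    and "s \<ge> 1" and "s - 1 = max_zero_order (pderiv p) {a..b}"
  shows "\<exists>\<delta>>0.
    (\<exists>K>0. \<forall>u\<in>{poly p a..poly p b}. \<forall>v\<in>{poly p a..poly p b}. \<bar>u - v\<bar> \<le> \<delta> \<longrightarrow>
       \<bar>inv_into {a..b} (poly p) u - inv_into {a..b} (poly p) v\<bar> \<le> K * \<bar>u - v\<bar> powr (1 / real s)) \<and>
    (\<exists>K'>0. \<forall>u\<in>{poly p a..poly p b}. \<forall>v\<in>{poly p a..poly p b}. \<bar>u - v\<bar> \<le> \<delta> \<longrightarrow>
       \<bar>inv_into {a..b} (poly p) u - inv_into {a..b} (poly p) v\<bar> \<le> K' * \<bar>u - v\<bar> powr (1 / real m))"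
proof -
  let ?g = "inv_into {a..b} (poly p)" and ?I = "{poly p a..poly p b}"
  have nz: "pderiv p \<noteq> 0"
    using assms(2,3) by (simp add: pderiv_eq_0_iff)
  have "order z (pderiv p) < s" if "z \<in> {a..b}" for z
    using order_le_max_zero_order[OF nz that] assms(5,6) by simp
  then have "increment_ge_power (poly p) s {a..b}"
    using assms(1,4) nz by (intro poly_increment_ge_power) auto
  then obtain K where K: "K > 0"
    "\<And>u v. u \<in> ?I \<Longrightarrow> v \<in> ?I \<Longrightarrow> \<bar>?g u - ?g v\<bar> \<le> K * \<bar>u - v\<bar> powr (1 / real s)"
    using poly_inverse_Holder[of a b s p] assms(1,5) by auto
  have "s \<le> m"
    using max_zero_order_le_degree[OF nz, of "{a..b}"] assms(2,3,5,6) by (simp add: degree_pderiv)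
  have small: "\<bar>?g u - ?g v\<bar> \<le> K * \<bar>u - v\<bar> powr (1 / real m)"
    if "u \<in> ?I" "v \<in> ?I" "\<bar>u - v\<bar> \<le> 1" for u v
  proof -
    have "\<bar>u - v\<bar> powr (1 / real s) \<le> \<bar>u - v\<bar> powr (1 / real m)"
      using \<open>s \<le> m\<close> assms(5) that(3) by (intro powr_mono') (auto simp: field_simps)
    then have "K * \<bar>u - v\<bar> powr (1 / real s) \<le> K * \<bar>u - v\<bar> powr (1 / real m)"
      using K(1) by simp
    then show ?thesis using K(2)[OF that(1,2)] by linarith
  qed
  show ?thesis
    by (rule exI[of _ 1], intro conjI exI[of _ K])
      (use K small in \<open>simp_all del: atLeastAtMost_iff\<close>)
qed

end
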